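(* Let $\Omega\subset\mathbb{C}$ be a (possibly unbounded) domain such that for every polynomial $p\in\mathbb{C}[z,\bar z]$ the Dirichlet problem on $\Omega$ with data $p|_{\partial\Omega}$ has a rational solution. Assume moreover that there exists a rational harmonic function $\phi$ with a singularity in $\Omega$ such that the Dirichlet problem on $\Omega$ with data $\phi|_{\partial\Omega}$ has a rational solution. Then there is a finite set $S$ such that $\partial\Omega\setminus S$ is a subset of a circle or of a line.
   Context: Solving the Dirichlet problem on $\Omega$ with boundary data $v\in C(\partial\Omega)$ means finding $u\in C^2(\Omega)\cap C(\overline\Omega)$ that is harmonic on $\Omega$ and satisfies $u|_{\partial\Omega}=v$. A rational harmonic function is an element of $\mathbb{C}(z)+\mathbb{C}(\bar z)$, i.e. a function $a(z)+b(\bar z)$ with $a,b$ rational functions of one variable over $\mathbb{C}$; a rational solution is a solution $u$ that is given by a rational harmonic function. A singularity of $a(z)+b(\bar z)$ is a point $z_0$ such that $z_0$ is a pole of $a$ or $\bar z_0$ is a pole of $b$. The data $\phi|_{\partial\Omega}$ is assumed to be a continuous function on $\partial\Omega$. *)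

theory Defs
  imports
    "HOL-Complex_Analysis.Complex_Analysis"
    "HOL-Computational_Algebra.Computational_Algebra"
    "HOL-Computational_Algebra.Field_as_Ring"
begin

section \<open>Rational harmonic functions\<close>

text \<open>
  The field of rational functions in one variable is the fraction field \<^typ>\<open>complex poly fract\<close>.
  Evaluation goes through the coprime representation, so that removable singularities of
  other representations do not matter. At a pole the value is the meaningless \<open>x / 0 = 0\<close>;
  every use below excludes the poles.
\<close>

definition rat_eval :: "complex poly fract \<Rightarrow> complex \<Rightarrow> complex" where
  "rat_eval r z = poly (fst (quot_of_fract r)) z / poly (snd (quot_of_fract r)) z"

lemma is_pole_rat_eval_iff:
  "is_pole (rat_eval r) z \<longleftrightarrow> poly (snd (quot_of_fract r)) z = 0"
proof -
  define p q where "p = fst (quot_of_fract r)" and "q = snd (quot_of_fract r)"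
  have co: "coprime p q" and q0: "q \<noteq> 0"
    unfolding p_def q_def using quot_of_fract_in_normalized_fracts[of r]
    by (auto simp: normalized_fracts_def)
  have ev: "rat_eval r = (\<lambda>z. poly p z / poly q z)" by (auto simp: rat_eval_def p_def q_def)
  show ?thesis
  proof (cases "poly q z = 0")
    case True
    then have "poly p z \<noteq> 0" using co coprime_poly_0 by blast
    have "finite {x. poly q x = 0}" using q0 poly_roots_finite by blast
    have "\<forall>\<^sub>F x in at z. poly q x \<noteq> 0"
      using \<open>finite _\<close> islimpt_finite[of "{x. poly q x = 0}" z] by (auto simp: islimpt_iff_eventually)
    then have "filterlim (poly q) (at 0) (at z)"
      unfolding filterlim_at using True by (auto intro!: tendsto_eq_intros)
    then have "is_pole (\<lambda>x. poly p x / poly q x) z"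
      unfolding is_pole_def
      by (intro filterlim_divide_at_infinity[where c = "poly p z"]) (use \<open>poly p z \<noteq> 0\<close> in \<open>auto intro!: tendsto_eq_intros\<close>)
    then show ?thesis using True ev q_def by simp
  next
    case False
    then have "(\<lambda>x. poly p x / poly q x) \<midarrow>z\<rightarrow> poly p z / poly q z"
      by (intro tendsto_intros)
    then have "\<not> is_pole (\<lambda>x. poly p x / poly q x) z"
      unfolding is_pole_def using not_tendsto_and_filterlim_at_infinity[of "at z"] by (metis trivial_limit_at)
    then show ?thesis using False ev q_def by simp
  qed
qed

text \<open>
  The pair \<open>(a, b)\<close> stands for the rational harmonic function \<open>a(z) + b(cnj z)\<close>. The pair is
  determined by the function up to an additive constant moved between the two components,
  which affects neither values nor singularities.
\<close>

type_synonym rat_harm = "complex poly fract \<times> complex poly fract"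

definition rh_eval :: "rat_harm \<Rightarrow> complex \<Rightarrow> complex" where
  "rh_eval h z = rat_eval (fst h) z + rat_eval (snd h) (cnj z)"

definition rh_singularity :: "rat_harm \<Rightarrow> complex \<Rightarrow> bool" where
  "rh_singularity h z \<longleftrightarrow> is_pole (rat_eval (fst h)) z \<or> is_pole (rat_eval (snd h)) (cnj z)"

section \<open>Polynomials in \<open>z\<close> and its conjugate\<close>

text \<open>
  In \<open>p :: complex poly poly\<close> the coefficients are polynomials in \<open>z\<close> and the outer variable
  stands for the conjugate of \<open>z\<close>.
\<close>

definition poly_z_cnj :: "complex poly poly \<Rightarrow> complex \<Rightarrow> complex" where
  "poly_z_cnj p z = poly (poly p [:cnj z:]) z"

lemma poly_z_cnj_altdef:
  "poly_z_cnj p z = (\<Sum>k\<le>degree p. poly (coeff p k) z * cnj z ^ k)"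
  by (simp add: poly_z_cnj_def poly_altdef[of p] poly_sum)

section \<open>The Dirichlet problem\<close>

text \<open>
  The derivative of \<open>u\<close> at \<open>z\<close> in direction \<open>d\<close>; the directions \<open>1\<close> and \<open>\<i>\<close> give the partial
  derivatives with respect to the real and the imaginary part.
\<close>

definition partial_deriv :: "complex \<Rightarrow> (complex \<Rightarrow> complex) \<Rightarrow> complex \<Rightarrow> complex" where
  "partial_deriv d u z = vector_derivative (\<lambda>t::real. u (z + of_real t * d)) (at 0)"

text \<open>Continuously differentiable \<open>k\<close> times in the real sense, on an open set.\<close>

primrec C_k_on :: "nat \<Rightarrow> (complex \<Rightarrow> complex) \<Rightarrow> complex set \<Rightarrow> bool" where
  "C_k_on 0 u A \<longleftrightarrow> continuous_on A u"
| "C_k_on (Suc k) u A \<longleftrightarrow> continuous_on A u \<and>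
     (\<forall>d\<in>{1, \<i>}. (\<forall>z\<in>A. (\<lambda>t::real. u (z + of_real t * d)) differentiable (at 0)) \<and>
                 C_k_on k (partial_deriv d u) A)"

definition harmonic_on :: "(complex \<Rightarrow> complex) \<Rightarrow> complex set \<Rightarrow> bool" where
  "harmonic_on u A \<longleftrightarrow> C_k_on 2 u A \<and>
     (\<forall>z\<in>A. partial_deriv 1 (partial_deriv 1 u) z + partial_deriv \<i> (partial_deriv \<i> u) z = 0)"

definition solves_dirichlet ::
  "complex set \<Rightarrow> (complex \<Rightarrow> complex) \<Rightarrow> (complex \<Rightarrow> complex) \<Rightarrow> bool" where
  "solves_dirichlet \<Omega> v u \<longleftrightarrow>
     harmonic_on u \<Omega> \<and> continuous_on (closure \<Omega>) u \<and> (\<forall>z\<in>frontier \<Omega>. u z = v z)"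

text \<open>
  A solution \<open>u\<close> is rational if it is given on \<open>\<Omega>\<close> by a rational harmonic function, which
  then has no singularity in \<open>\<Omega>\<close>. On the boundary \<open>u\<close> is the continuous extension, so that
  singularities of the rational harmonic function there are not excluded.
\<close>

definition has_rational_solution :: "complex set \<Rightarrow> (complex \<Rightarrow> complex) \<Rightarrow> bool" where
  "has_rational_solution \<Omega> v \<longleftrightarrow>
     (\<exists>u h. solves_dirichlet \<Omega> v u \<and> (\<forall>z\<in>\<Omega>. \<not> rh_singularity h z \<and> u z = rh_eval h z))"

text \<open>
  Continuous boundary data \<open>v\<close> given by \<open>h\<close>. If \<open>h\<close> has no singularity on the boundary, this
  says \<open>v = h\<close> there; otherwise \<open>v\<close> is a continuous extension of \<open>h\<close> to its singularities
  on the boundary.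
\<close>

definition boundary_data_of :: "rat_harm \<Rightarrow> complex set \<Rightarrow> (complex \<Rightarrow> complex) \<Rightarrow> bool" where
  "boundary_data_of h \<Omega> v \<longleftrightarrow> continuous_on (frontier \<Omega>) v \<and>
     (\<forall>z\<in>frontier \<Omega>. \<not> rh_singularity h z \<longrightarrow> v z = rh_eval h z)"

end

theory Submission
  imports Defs
begin

text \<open>
  Comparing \<open>\<phi>\<close> with its rational solution gives nonconstant rational functions with
  \<open>A(z) = B(w)\<close>, \<open>w = cnj z\<close>, on the boundary up to a finite set; by symmetry let
  \<open>d = deg A \<ge> deg B\<close>. The polynomial data give \<open>z\<^sup>i w = a\<^sub>i(z) + b\<^sub>i(w)\<close>. Put \<open>t = A(z) = B(w)\<close>.
  The \<open>d + 1\<close> functions \<open>1, b\<^sub>0, \<dots>, b\<^bsub>d-1\<^esub>\<close> of \<open>w\<close> are linearly dependent over \<open>\<complex>(t)\<close>, since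
  \<open>\<complex>(w)\<close> has degree \<open>deg B \<le> d\<close> over \<open>\<complex>(t)\<close>, whereas \<open>1, z, \<dots>, z\<^bsup>d-1\<^esup>\<close> are independent. The
  dependence therefore turns into \<open>w \<Lambda>(z) = M(z)\<close> with \<open>\<Lambda> \<noteq> 0\<close>, so that \<open>cnj z = R(z)\<close> on almost
  all of the boundary, with \<open>R\<close> rational. Conjugating shows that \<open>R\<close> has a left inverse, hence \<open>R\<close>
  is injective and of degree at most one, and \<open>cnj z = R(z)\<close> is the equation of a circle or a line.
\<close>

section \<open>Elimination over the field of rational functions\<close>

text \<open>Gaussian elimination on the top coefficient: a pivot \<open>h l\<close> with nonzero
  coefficient at \<open>N\<close> clears that coefficient from all other members. This costs one
  polynomial and lowers the bound by one, so the surplus of members over coefficients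
  persists.\<close>

lemma poly_linear_dependent:
  fixes h :: "'i \<Rightarrow> 'a::field poly"
  assumes "finite I" "N < card I" "\<And>i k. i \<in> I \<Longrightarrow> N \<le> k \<Longrightarrow> coeff (h i) k = 0"
  shows "\<exists>c. (\<exists>i\<in>I. c i \<noteq> 0) \<and> (\<Sum>i\<in>I. smult (c i) (h i)) = 0"
  using assms
proof (induction N arbitrary: I h)
  case 0
  then have "h i = 0" if "i \<in> I" for i
    using that by (intro poly_eqI) auto
  moreover have "I \<noteq> {}" using 0 by auto
  ultimately show ?case by (intro exI[of _ "\<lambda>_. 1"]) auto
next
  case (Suc N)
  show ?case
  proof (cases "\<forall>i\<in>I. coeff (h i) N = 0")
    case True
    then have "coeff (h i) k = 0" if "i \<in> I" "N \<le> k" for i k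
      using that Suc.prems(3)[of i k] by (cases "k = N") auto
    then show ?thesis using Suc.IH[of I h] Suc.prems by auto
  next
    case False
    then obtain l where l: "l \<in> I" "coeff (h l) N \<noteq> 0" by auto
    define e where "e i = coeff (h i) N / coeff (h l) N" for i
    define h' where "h' i = h i - smult (e i) (h l)" for i
    have "coeff (h' i) k = 0" if "i \<in> I - {l}" "N \<le> k" for i k
      using that l Suc.prems(3)[of i k] Suc.prems(3)[of l k] by (cases "k = N") (auto simp: h'_def e_def)
    moreover have "finite (I - {l})" "N < card (I - {l})"
      using Suc.prems(1,2) l(1) by (auto simp: card_Diff_singleton)
    ultimately obtain c where c: "\<exists>i\<in>I - {l}. c i \<noteq> 0" "(\<Sum>i\<in>I - {l}. smult (c i) (h' i)) = 0"
      using Suc.IH[of "I - {l}" h'] by blast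
    define c' where "c' = c(l := - (\<Sum>i\<in>I - {l}. c i * e i))"
    have "(\<Sum>i\<in>I. smult (c' i) (h i)) = smult (c' l) (h l) + (\<Sum>i\<in>I - {l}. smult (c' i) (h i))"
      using Suc.prems(1) l(1) by (rule sum.remove)
    also have "(\<Sum>i\<in>I - {l}. smult (c' i) (h i)) = (\<Sum>i\<in>I - {l}. smult (c i) (h' i) + smult (c i * e i) (h l))"
      by (intro sum.cong) (auto simp: c'_def h'_def smult_diff_right)
    also have "\<dots> = smult (\<Sum>i\<in>I - {l}. c i * e i) (h l)"
      by (simp add: sum.distrib c(2) smult_sum)
    also have "smult (c' l) (h l) + \<dots> = 0"
      by (simp add: c'_def flip: smult_add_left)
    finally show ?thesis using c(1) by (intro exI[of _ c']) (auto simp: c'_def)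
  qed
qed

text \<open>The top term is the only one without a factor \<open>q\<close>. By coprimality
  \<open>q\<close> divides \<open>u m\<close>, which the degree bound forces to be zero; then cancel
  \<open>q\<close> and descend. This is the independence of 1, z, ..., z^(d-1) over the rational
  functions of p/q, with d the degree of \<open>q\<close>: the coefficient of the j-th power of p/q
  is collected in \<open>u j\<close>.\<close>

lemma rational_powers_independent:
  fixes p q :: "'a::field_gcd poly"
  assumes "coprime p q" "\<And>j. j \<le> m \<Longrightarrow> u j = 0 \<or> degree (u j) < degree q"
    "(\<Sum>j\<le>m. u j * p ^ j * q ^ (m - j)) = 0" "j \<le> m"
  shows "u j = 0"
  using assms(2-)
proof (induction m arbitrary: j)
  case 0
  then show ?case by simp
next
  case (Suc m)
  have split: "(\<Sum>j\<le>m. u j * p ^ j * q ^ (Suc m - j)) = q * (\<Sum>j\<le>m. u j * p ^ j * q ^ (m - j))"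
    by (auto simp: sum_distrib_left Suc_diff_le intro!: sum.cong)
  have eq: "q * (\<Sum>j\<le>m. u j * p ^ j * q ^ (m - j)) + u (Suc m) * p ^ Suc m = 0"
    using Suc.prems(2) by (simp only: sum.atMost_Suc split) simp
  then have "q dvd u (Suc m) * p ^ Suc m"
    using dvd_add_right_iff[of q "q * (\<Sum>j\<le>m. u j * p ^ j * q ^ (m - j))" "u (Suc m) * p ^ Suc m"]
    by (simp only: dvd_triv_left dvd_0_right)
  moreover have "coprime q (p ^ Suc m)"
    using assms(1) by (intro coprime_power_right_iff[THEN iffD2]) (simp add: coprime_commute)
  ultimately have "q dvd u (Suc m)"
    using coprime_dvd_mult_left_iff by blast
  then have top: "u (Suc m) = 0"
    using Suc.prems(1)[of "Suc m"] dvd_imp_degree_le[of q "u (Suc m)"] by linarith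
  show ?case
  proof (cases "j = Suc m \<or> q = 0")
    case True
    then show ?thesis using top Suc.prems(1)[of j] Suc.prems(3) by auto
  next
    case False
    then have "(\<Sum>j\<le>m. u j * p ^ j * q ^ (m - j)) = 0"
      using eq top by simp
    then show ?thesis using Suc.IH[of j] Suc.prems False by auto
  qed
qed

text \<open>The degree falls only if the coefficients at the larger of the two degrees cancel, which
  singles out at most one \<open>c\<close>.\<close>

lemma finite_degree_drop:
  fixes p q :: "'a::field poly"
  shows "finite {c. degree (p - smult c q) \<noteq> max (degree p) (degree q)}" (is "finite ?B")
proof -
  define d where "d = max (degree p) (degree q)"
  have "c = coeff p d / coeff q d" if "c \<in> ?B" for c
  proof -
    have "degree (p - smult c q) \<le> d"
      unfolding d_def by (intro degree_diff_le_max[THEN order_trans]) (auto simp: degree_smult_le max.coboundedI2)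
    then have lt: "degree (p - smult c q) < d"
      using that d_def by auto
    then have eq: "coeff p d = c * coeff q d"
      using coeff_eq_0[of "p - smult c q" d] by simp
    moreover have "coeff q d \<noteq> 0"
    proof
      assume "coeff q d = 0"
      then have "coeff p d = 0" using eq by simp
      then show False using \<open>coeff q d = 0\<close> lt
        using leading_coeff_0_iff[of p] leading_coeff_0_iff[of q]
        by (cases "degree p \<le> degree q") (auto simp: d_def max_def)
    qed
    ultimately show ?thesis by simp
  qed
  then have "?B \<subseteq> {coeff p d / coeff q d}" by blast
  then show ?thesis by (rule finite_subset) simp
qed

lemma rational_reduce:
  fixes p q :: "'a::field_gcd poly"
  assumes "q \<noteq> 0"
  obtains p' q' where "coprime p' q'" "q' \<noteq> 0" "p * q' = p' * q"
proof -
  obtain p' q' where "p = p' * gcd p q" "q = q' * gcd p q" "coprime p' q'"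
    using gcd_coprime_exists[of p q] assms by auto
  moreover from this have "q' \<noteq> 0" using assms by auto
  moreover have "(p' * gcd p q) * q' = p' * (q' * gcd p q)" by (simp only: ac_simps)
  ultimately show thesis using that[of p' q'] by simp
qed

lemma divide_power_homogenize:
  fixes p q :: "'a::field"
  assumes "q \<noteq> 0" "j \<le> m"
  shows "p ^ j * q ^ (m - j) = q ^ m * (p / q) ^ j"
  using assms by (simp add: power_divide power_diff)

text \<open>The linear algebra over the field of rational functions in T = p(x)/q(x) = r(y)/s(y) is
  done by counting coefficients of polynomials in y. The assumptions on \<open>x\<close> and
  \<open>y\<close> make them behave like transcendentals: a polynomial vanishing eventually at
  either one is zero.\<close>

lemma rational_relation:
  fixes G :: "'b filter" and x y :: "'b \<Rightarrow> 'a::field_gcd"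
  assumes G: "G \<noteq> bot"
    and x: "\<And>f. f \<noteq> 0 \<Longrightarrow> \<forall>\<^sub>F t in G. poly f (x t) \<noteq> 0"
    and y: "\<And>f. f \<noteq> 0 \<Longrightarrow> \<forall>\<^sub>F t in G. poly f (y t) \<noteq> 0"
    and pq: "coprime p q" "degree q = d" "0 < d"
    and rs: "s \<noteq> 0" "degree r \<le> d" "degree s \<le> d"
    and eq: "\<forall>\<^sub>F t in G. poly p (x t) / poly q (x t) = poly r (y t) / poly s (y t)"
    and split: "\<And>i. \<exists>a c b e. c \<noteq> 0 \<and> e \<noteq> 0 \<and>
      (\<forall>\<^sub>F t in G. x t ^ i * y t = poly a (x t) / poly c (x t) + poly b (y t) / poly e (y t))"
  shows "\<exists>P Q. Q \<noteq> 0 \<and> (\<forall>\<^sub>F t in G. poly Q (x t) * y t = poly P (x t))"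
proof -
  have "\<forall>i. \<exists>w. case w of (a, c, b, e) \<Rightarrow> c \<noteq> 0 \<and> e \<noteq> 0 \<and>
      (\<forall>\<^sub>F t in G. x t ^ i * y t = poly a (x t) / poly c (x t) + poly b (y t) / poly e (y t))"
    using split by (simp add: split_paired_Ex)
  then obtain f where f: "\<forall>i. case f i of (a, c, b, e) \<Rightarrow> c \<noteq> 0 \<and> e \<noteq> 0 \<and>
      (\<forall>\<^sub>F t in G. x t ^ i * y t = poly a (x t) / poly c (x t) + poly b (y t) / poly e (y t))"
    by (rule choice[THEN exE])
  define a c b e where "a i = fst (f i)" "c i = fst (snd (f i))" "b i = fst (snd (snd (f i)))" "e i = snd (snd (snd (f i)))" for i
  have c: "c i \<noteq> 0" and e: "e i \<noteq> 0"
    and abce: "\<forall>\<^sub>F t in G. x t ^ i * y t = poly (a i) (x t) / poly (c i) (x t) + poly (b i) (y t) / poly (e i) (y t)" for i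
    using f[rule_format, of i] by (auto simp: case_prod_unfold a_c_b_e_def)
  \<comment> \<open>\<open>C\<close> and \<open>E\<close> are common denominators, and
    \<open>a' i\<close>, \<open>g i\<close> the numerators of \<open>a i / c i\<close> and
    \<open>b i / e i\<close> over them. The extra index \<open>d\<close> stands for the constant
    function 1, whose numerator over \<open>E\<close> is \<open>E\<close> itself.\<close>
  define C where "C = (\<Prod>i<d. c i)"
  define a' where "a' i = a i * (\<Prod>k\<in>{..<d} - {i}. c k)" for i
  define E where "E = (\<Prod>i<d. e i)"
  define g where "g i = (if i < d then b i * (\<Prod>k\<in>{..<d} - {i}. e k) else E)" for i
  have C0: "C \<noteq> 0" and E0: "E \<noteq> 0" and q0: "q \<noteq> 0"
    using c e pq(2,3) by (auto simp: C_def E_def)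
  have C_split: "C = c i * (\<Prod>k\<in>{..<d} - {i}. c k)" and E_split: "E = e i * (\<Prod>k\<in>{..<d} - {i}. e k)"
    if "i < d" for i
    using that unfolding C_def E_def by (auto intro!: prod.remove)
  have a'_eval: "poly (a' i) z = poly C z * (poly (a i) z / poly (c i) z)" if "poly C z \<noteq> 0" "i < d" for i z
    using that C_split[OF that(2)] by (auto simp: a'_def)
  have g_eval: "poly (g i) z = poly E z * (poly (b i) z / poly (e i) z)" if "poly E z \<noteq> 0" "i < d" for i z
    using that E_split[OF that(2)] by (auto simp: g_def)
  \<comment> \<open>Any \<open>m\<close> this large leaves more unknown coefficients than equations.\<close>
  define m where "m = (\<Sum>i\<le>d. degree (g i))"
  \<comment> \<open>At y this is the product of the i-th function and T^j, multiplied by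
    \<open>E * s ^ m\<close> to clear denominators.\<close>
  define h where "h = (\<lambda>(i, j). g i * r ^ j * s ^ (m - j))"
  have "coeff (h ij) k = 0" if "ij \<in> {..d} \<times> {..m}" "Suc (m + d * m) \<le> k" for ij k
  proof -
    obtain i j where ij: "ij = (i, j)" "i \<le> d" "j \<le> m" using \<open>ij \<in> _\<close> by auto
    have "degree (g i) \<le> m"
      unfolding m_def using ij by (intro member_le_sum) auto
    moreover have "degree (r ^ j) \<le> d * j"
      using degree_power_le[of r j] rs(2) by (meson le_trans mult_le_mono1)
    moreover have "degree (s ^ (m - j)) \<le> d * (m - j)"
      using degree_power_le[of s "m - j"] rs(3) by (meson le_trans mult_le_mono1)
    ultimately have "degree (h ij) \<le> m + d * j + d * (m - j)"
      unfolding h_def ij(1) case_prod_conv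
      by (intro order_trans[OF degree_mult_le] add_mono) auto
    also have "\<dots> = m + d * m"
      using ij(3) by (simp add: add.assoc flip: distrib_left)
    finally show ?thesis using that(2) by (intro coeff_eq_0) simp
  qed
  moreover have "Suc (m + d * m) < card ({..d} \<times> {..m})"
    using pq(3) by (simp add: card_cartesian_product)
  ultimately obtain l where l: "\<exists>ij\<in>{..d} \<times> {..m}. l ij \<noteq> 0"
    and l0: "(\<Sum>ij\<in>{..d} \<times> {..m}. smult (l ij) (h ij)) = 0"
    using poly_linear_dependent[of "{..d} \<times> {..m}" "Suc (m + d * m)" h] by blast
  \<comment> \<open>Substituting b_i = x^i y - a_i into the dependence and sorting by powers of T
    gives y times the sum of the \<open>u j\<close> T^j on one side. The other side has the
    coefficients \<open>R j / C\<close>. \<open>L\<close> and \<open>P\<close> result from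
    multiplying by \<open>q ^ m\<close>, and \<open>P\<close> also carries the factor
    \<open>C\<close>.\<close>
  define u where "u j = (\<Sum>i<d. monom (l (i, j)) i)" for j
  define L where "L = (\<Sum>j\<le>m. u j * p ^ j * q ^ (m - j))"
  define R where "R j = (\<Sum>i<d. smult (l (i, j)) (a' i)) - smult (l (d, j)) C" for j
  define P where "P = (\<Sum>j\<le>m. R j * p ^ j * q ^ (m - j))"
  have hom: "poly (\<Sum>j\<le>m. f j * p ^ j * q ^ (m - j)) z = poly q z ^ m * (\<Sum>j\<le>m. poly (f j) z * (poly p z / poly q z) ^ j)"
    if "poly q z \<noteq> 0" for f z
    using divide_power_homogenize[OF that, of _ m "poly p z"] by (simp add: poly_sum sum_distrib_left mult_ac)
  \<comment> \<open>The dependence after division by \<open>E * s ^ m\<close>, with T now read as a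
    function of x; y survives only linearly.\<close>
  have rel: "\<forall>\<^sub>F t in G. poly q (x t) \<noteq> 0 \<and> poly C (x t) \<noteq> 0 \<and>
     (\<Sum>j\<le>m. ((\<Sum>i<d. l (i, j) * (x t ^ i * y t - poly (a i) (x t) / poly (c i) (x t))) + l (d, j)) *
       (poly p (x t) / poly q (x t)) ^ j) = 0"
  proof -
    have "\<forall>\<^sub>F t in G. \<forall>i\<in>{..<d}. x t ^ i * y t = poly (a i) (x t) / poly (c i) (x t) + poly (b i) (y t) / poly (e i) (y t)"
      using abce by (intro eventually_ball_finite) auto
    then show ?thesis
      using x[OF q0] x[OF C0] y[OF E0] y[OF rs(1)] eq
    proof eventually_elim
      case (elim t)
      define T where "T = poly p (x t) / poly q (x t)"
      have "0 = poly (\<Sum>ij\<in>{..d} \<times> {..m}. smult (l ij) (h ij)) (y t)"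
        by (simp add: l0)
      also have "\<dots> = (\<Sum>i\<le>d. \<Sum>j\<le>m. l (i, j) * (poly (g i) (y t) * poly r (y t) ^ j * poly s (y t) ^ (m - j)))"
        by (simp add: poly_sum h_def sum.cartesian_product case_prod_unfold)
      also have "\<dots> = (\<Sum>i\<le>d. \<Sum>j\<le>m. l (i, j) * (poly (g i) (y t) * (poly s (y t) ^ m * T ^ j)))"
        using divide_power_homogenize[OF \<open>poly s (y t) \<noteq> 0\<close>, of _ m "poly r (y t)"] elim(6)
        by (intro sum.cong) (auto simp: T_def mult.assoc)
      also have "\<dots> = (\<Sum>j\<le>m. \<Sum>i\<le>d. l (i, j) * (poly (g i) (y t) * (poly s (y t) ^ m * T ^ j)))"
        by (rule sum.swap)
      also have "\<dots> = (\<Sum>j\<le>m. poly s (y t) ^ m * poly E (y t) * (((\<Sum>i<d. l (i, j) * (x t ^ i * y t - poly (a i) (x t) / poly (c i) (x t))) + l (d, j)) * T ^ j))"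
      proof (intro sum.cong refl)
        fix j
        have "(\<Sum>i\<le>d. l (i, j) * (poly (g i) (y t) * (poly s (y t) ^ m * T ^ j))) =
          (\<Sum>i<d. l (i, j) * (poly (g i) (y t) * (poly s (y t) ^ m * T ^ j))) + l (d, j) * (poly E (y t) * (poly s (y t) ^ m * T ^ j))"
          by (simp add: lessThan_Suc_atMost[symmetric] g_def)
        also have "(\<Sum>i<d. l (i, j) * (poly (g i) (y t) * (poly s (y t) ^ m * T ^ j))) =
          (poly s (y t) ^ m * poly E (y t) * T ^ j) * (\<Sum>i<d. l (i, j) * (x t ^ i * y t - poly (a i) (x t) / poly (c i) (x t)))"
          unfolding sum_distrib_left using elim g_eval by (intro sum.cong) auto
        finally show "(\<Sum>i\<le>d. l (i, j) * (poly (g i) (y t) * (poly s (y t) ^ m * T ^ j))) =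
          poly s (y t) ^ m * poly E (y t) * (((\<Sum>i<d. l (i, j) * (x t ^ i * y t - poly (a i) (x t) / poly (c i) (x t))) + l (d, j)) * T ^ j)"
          by (simp add: algebra_simps)
      qed
      finally show ?case using elim by (simp add: T_def flip: sum_distrib_left)
    qed
  qed
  have PL: "\<forall>\<^sub>F t in G. poly (C * L) (x t) * y t = poly P (x t)"
    using rel
  proof eventually_elim
    case (elim t)
    define T where "T = poly p (x t) / poly q (x t)"
    have "poly (C * L) (x t) * y t - poly P (x t) = poly q (x t) ^ m * (\<Sum>j\<le>m. (poly C (x t) * poly (u j) (x t) * y t - poly (R j) (x t)) * T ^ j)"
      unfolding L_def P_def poly_mult using elim
      by (subst (1 2) hom) (auto simp: T_def sum_subtractf sum_distrib_left sum_distrib_right algebra_simps)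
    also have "(\<Sum>j\<le>m. (poly C (x t) * poly (u j) (x t) * y t - poly (R j) (x t)) * T ^ j) =
      (\<Sum>j\<le>m. poly C (x t) * (((\<Sum>i<d. l (i, j) * (x t ^ i * y t - poly (a i) (x t) / poly (c i) (x t))) + l (d, j)) * T ^ j))"
    proof (intro sum.cong refl)
      fix j
      have "poly C (x t) * poly (u j) (x t) * y t - (\<Sum>i<d. l (i, j) * poly (a' i) (x t)) =
        poly C (x t) * (\<Sum>i<d. l (i, j) * (x t ^ i * y t - poly (a i) (x t) / poly (c i) (x t)))"
        unfolding u_def poly_sum poly_monom sum_distrib_left sum_distrib_right sum_subtractf[symmetric]
        using a'_eval elim by (intro sum.cong) (auto simp: algebra_simps)
      then show "(poly C (x t) * poly (u j) (x t) * y t - poly (R j) (x t)) * T ^ j =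
         poly C (x t) * (((\<Sum>i<d. l (i, j) * (x t ^ i * y t - poly (a i) (x t) / poly (c i) (x t))) + l (d, j)) * T ^ j)"
        by (simp add: R_def poly_sum algebra_simps)
    qed
    also have "\<dots> = 0"
      using elim by (simp add: T_def flip: sum_distrib_left)
    finally show ?case by simp
  qed
  \<comment> \<open>If \<open>L\<close> vanished, independence would kill all
    \<open>l (i, j)\<close> with \<open>i < d\<close>. What remains of \<open>rel\<close> is a
    relation between powers of T with constant coefficients \<open>l (d, j)\<close>, and since
    \<open>0 < d\<close> independence applies to constants too. Then all of \<open>l\<close> would
    be zero.\<close>
  have "L \<noteq> 0"
  proof
    assume L0: "L = 0"
    have "degree (u j) < d" for j
      unfolding u_def using pq(3) by (intro degree_sum_less) (auto intro: le_less_trans[OF degree_monom_le])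
    then have "u j = 0" if "j \<le> m" for j
      using rational_powers_independent[OF pq(1), of m u j] that L0 pq(2) by (auto simp: L_def)
    then have l_less: "l (i, j) = 0" if "i < d" "j \<le> m" for i j
    proof -
      have "coeff (u j) i = l (i, j)"
        using that by (simp add: u_def coeff_sum coeff_monom)
      then show ?thesis using \<open>\<And>j. j \<le> m \<Longrightarrow> u j = 0\<close> that by simp
    qed
    define L' where "L' = (\<Sum>j\<le>m. [:l (d, j):] * p ^ j * q ^ (m - j))"
    have ev: "\<forall>\<^sub>F t in G. poly L' (x t) = 0"
      using rel
    proof eventually_elim
      case (elim t)
      then show ?case unfolding L'_def by (subst hom) (auto simp: l_less)
    qed
    have "L' = 0"
    proof (rule ccontr)
      assume "L' \<noteq> 0"
      from x[OF this] ev have "\<forall>\<^sub>F t in G. False"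
        by eventually_elim simp
      then show False using G by simp
    qed
    then have ld: "[:l (d, j):] = 0" if "j \<le> m" for j
      using rational_powers_independent[OF pq(1), of m "\<lambda>j. [:l (d, j):]" j] that pq(2,3) by (auto simp: L'_def)
    then have "l (i, j) = 0" if "i \<le> d" "j \<le> m" for i j
      using l_less[of i j] ld[of j] that by (cases "i = d") auto
    then show False using l by auto
  qed
  then have "C * L \<noteq> 0" using C0 by simp
  then show ?thesis using PL by blast
qed

text \<open>Reduction to \<open>rational_relation\<close>, where \<open>q\<close> must attain the
  degree bound \<open>d\<close>. A constant \<open>c\<close> avoiding the exceptional values of both
  pairs is available because each pair has only finitely many.\<close>

lemma rational_relation_of_lower_degree:
  fixes G :: "'b filter" and x y :: "'b \<Rightarrow> complex"
  assumes G: "G \<noteq> bot"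
    and x: "\<And>f. f \<noteq> 0 \<Longrightarrow> \<forall>\<^sub>F t in G. poly f (x t) \<noteq> 0"
    and y: "\<And>f. f \<noteq> 0 \<Longrightarrow> \<forall>\<^sub>F t in G. poly f (y t) \<noteq> 0"
    and cop: "coprime p q" and nz: "q \<noteq> 0" "s \<noteq> 0"
    and deg: "max (degree r) (degree s) \<le> max (degree p) (degree q)" "0 < max (degree r) (degree s)"
    and eq: "\<forall>\<^sub>F t in G. poly p (x t) / poly q (x t) = poly r (y t) / poly s (y t)"
    and split: "\<And>i. \<exists>a c b e. c \<noteq> 0 \<and> e \<noteq> 0 \<and>
      (\<forall>\<^sub>F t in G. x t ^ i * y t = poly a (x t) / poly c (x t) + poly b (y t) / poly e (y t))"
  shows "\<exists>P Q. Q \<noteq> 0 \<and> (\<forall>\<^sub>F t in G. poly Q (x t) * y t = poly P (x t))"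
proof -
  have "finite ({c. degree (p - smult c q) \<noteq> max (degree p) (degree q)} \<union>
      {c. degree (r - smult c s) \<noteq> max (degree r) (degree s)})"
    using finite_degree_drop by blast
  from ex_new_if_finite[OF infinite_UNIV_char_0 this]
  obtain c where c: "degree (p - smult c q) = max (degree p) (degree q)"
      "degree (r - smult c s) = max (degree r) (degree s)"
    by blast
  \<comment> \<open>Replacing \<open>t\<close> by \<open>1 / (t - c)\<close> makes the denominators attain the degrees of the two functions.\<close>
  have "coprime q (p - smult c q)"
  proof (rule coprimeI)
    fix d assume d: "d dvd q" "d dvd p - smult c q"
    then have "d dvd (p - smult c q) + smult c q"
      by (intro dvd_add dvd_smult)
    then show "is_unit d"
      using coprime_common_divisor[OF cop] d(1) by simp
  qed
  moreover have "\<forall>\<^sub>F t in G. poly q (x t) / poly (p - smult c q) (x t) = poly s (y t) / poly (r - smult c s) (y t)"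
    using eq x[OF nz(1)] y[OF nz(2)]
  proof eventually_elim
    case (elim t)
    \<comment> \<open>Where the common value equals \<open>c\<close>, both sides are 0 by the
      convention for division by zero.\<close>
    have "poly q (x t) / poly (p - smult c q) (x t) = inverse (poly p (x t) / poly q (x t) - c)"
      using elim by (simp add: divide_simps)
    also have "\<dots> = poly s (y t) / poly (r - smult c s) (y t)"
      unfolding elim(1) using elim by (simp add: divide_simps)
    finally show ?case .
  qed
  moreover have "r - smult c s \<noteq> 0" using c(2) deg(2) by (metis degree_0 less_irrefl)
  ultimately show ?thesis
    using c deg by (intro rational_relation[OF G x y, where p = q and q = "p - smult c q" and r = s and
          s = "r - smult c s" and d = "max (degree p) (degree q)"] split) auto
qed

text \<open>If \<open>c\<close> is the constant value, \<open>p - smult c q\<close> vanishes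
  eventually and hence identically; coprimality then makes \<open>q\<close> a unit. Applied in both
  directions, this shows that neither side of A(z) = B(w) is constant unless the other is.\<close>

lemma rational_eq_constant:
  fixes G :: "'b filter" and x y :: "'b \<Rightarrow> complex"
  assumes G: "G \<noteq> bot"
    and x: "\<And>f. f \<noteq> 0 \<Longrightarrow> \<forall>\<^sub>F t in G. poly f (x t) \<noteq> 0"
    and cop: "coprime p q" and nz: "q \<noteq> 0"
    and deg: "degree r = 0" "degree s = 0"
    and eq: "\<forall>\<^sub>F t in G. poly p (x t) / poly q (x t) = poly r (y t) / poly s (y t)"
  shows "degree p = 0 \<and> degree q = 0"
proof -
  define c where "c = poly r 0 / poly s 0"
  have c: "poly r v / poly s v = c" for v
    using deg by (auto simp: c_def elim!: degree_eq_zeroE)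
  have "p - smult c q = 0"
  proof (rule ccontr)
    assume "p - smult c q \<noteq> 0"
    from x[OF this] eq x[OF nz] have "\<forall>\<^sub>F t in G. False"
      by eventually_elim (auto simp: c field_simps)
    then show False using G by simp
  qed
  then have p: "p = smult c q" by simp
  then have "q dvd 1" using cop by (auto simp: coprime_def dvd_smult)
  then show ?thesis using p by (auto simp: is_unit_iff_degree nz)
qed

text \<open>The pole of p1/q1 at \<open>z\<close> cannot be cancelled by p2/q2, which is regular
  there. This is how the singularity of the boundary data inside the domain is exploited.\<close>

lemma reduced_difference_nonconstant:
  fixes p q :: "complex poly"
  assumes "coprime p1 q1" "poly q1 z = 0" "poly q2 z \<noteq> 0"
    and "(p1 * q2 - p2 * q1) * q = p * (q1 * q2)" "q \<noteq> 0"
  shows "0 < max (degree p) (degree q)"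
proof (rule ccontr)
  assume "\<not> ?thesis"
  then obtain a b where ab: "p = [:a:]" "q = [:b:]"
    by (auto elim!: degree_eq_zeroE)
  have "poly ((p1 * q2 - p2 * q1) * q) z = poly (p * (q1 * q2)) z"
    using assms(4) by simp
  then have "poly p1 z = 0" using ab assms(2,3,5) by auto
  then show False using coprime_poly_0[OF assms(1), of z] assms(2) by simp
qed

section \<open>Rational Schwarz functions\<close>

lemma poly_homogenization:
  fixes f P Q :: "'a::field poly"
  assumes "degree f \<le> n"
  shows "\<exists>H. \<forall>z. poly Q z \<noteq> 0 \<longrightarrow> poly H z = poly Q z ^ n * poly f (poly P z / poly Q z)"
proof (intro exI allI impI)
  fix z assume Q: "poly Q z \<noteq> 0"
  have "poly f v = (\<Sum>k\<le>n. coeff f k * v ^ k)" for v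
    unfolding poly_altdef using assms by (intro sum.mono_neutral_left) (auto simp: coeff_eq_0)
  moreover note divide_power_homogenize[OF Q, of _ n "poly P z"]
  ultimately show "poly (\<Sum>k\<le>n. smult (coeff f k) (P ^ k * Q ^ (n - k))) z = poly Q z ^ n * poly f (poly P z / poly Q z)"
    by (simp add: poly_sum sum_distrib_left mult_ac)
qed

text \<open>In degree at least two, injectivity would make all but finitely many values critical
  values. The Wronskian, up to sign the numerator of the derivative of P/Q, is nonzero and has only
  finitely many zeros.\<close>

lemma degree_le_1_if_injective:
  fixes P Q :: "complex poly"
  assumes cop: "coprime P Q"
    and inj: "\<And>w z. poly Q w \<noteq> 0 \<Longrightarrow> poly Q z \<noteq> 0 \<Longrightarrow> poly P w / poly Q w = poly P z / poly Q z \<Longrightarrow> w = z"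
  shows "degree P \<le> 1 \<and> degree Q \<le> 1"
proof (rule ccontr)
  define n where "n = max (degree P) (degree Q)"
  assume "\<not> ?thesis"
  then have n: "n \<ge> 2" by (auto simp: n_def)
  define W where "W = P * pderiv Q - pderiv P * Q"
  have W: "W \<noteq> 0"
  proof
    assume "W = 0"
    then have eq: "P * pderiv Q = pderiv P * Q" by (simp add: W_def)
    then have "Q dvd pderiv Q" "P dvd pderiv P"
      using cop by (metis coprime_commute coprime_dvd_mult_right_iff dvd_triv_right,
        metis cop coprime_dvd_mult_left_iff dvd_triv_left)
    then have "degree Q = 0" "degree P = 0"
      using not_dvd_pderiv by blast+
    then show False using n by (simp add: n_def)
  qed
  \<comment> \<open>By injectivity \<open>P - v Q\<close> has a single root, which is multiple and hence a zero of the Wronskian \<open>W\<close>.\<close>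
  have "v \<in> (\<lambda>z. poly P z / poly Q z) ` {z. poly W z = 0}" if v: "degree (P - smult v Q) = n" for v
  proof -
    have rootD: "poly Q z \<noteq> 0 \<and> v = poly P z / poly Q z" if "poly (P - smult v Q) z = 0" for z
    proof -
      have "poly P z = v * poly Q z" using that by simp
      then show ?thesis using coprime_poly_0[OF cop, of z] by auto
    qed
    obtain w where w: "poly (P - smult v Q) w = 0"
      using n v fundamental_theorem_of_algebra_alt[of "P - smult v Q"]
      by (metis degree_pCons_0 not_numeral_le_zero)
    then have "[:- w, 1:] dvd P - smult v Q"
      by (simp only: poly_eq_0_iff_dvd)
    then obtain g where g: "P - smult v Q = [:- w, 1:] * g"
      by (rule dvdE)
    then have "g \<noteq> 0" using n v by auto
    then have "degree g = n - 1"
      using arg_cong[OF g, of degree] v by (subst (asm) degree_mult_eq) auto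
    then obtain w' where w': "poly g w' = 0"
      using n fundamental_theorem_of_algebra_alt[of g] by (metis degree_pCons_0 diff_is_0_eq not_numeral_le_zero one_le_numeral le_trans not_less_eq_eq numeral_2_eq_2 One_nat_def)
    then have "poly (P - smult v Q) w' = 0" by (simp add: g)
    then have "w' = w" using inj[of w' w] rootD[of w] rootD[of w'] w by metis
    then have "poly (pderiv (P - smult v Q)) w = 0"
      unfolding g pderiv_mult using w' by simp
    then have "poly (pderiv P) w = v * poly (pderiv Q) w"
      by (simp add: pderiv_diff pderiv_smult)
    then have "poly W w = 0" using w by (simp add: W_def)
    then show ?thesis using rootD[OF w] by blast
  qed
  then have "UNIV \<subseteq> (\<lambda>z. poly P z / poly Q z) ` {z. poly W z = 0} \<union> {v. degree (P - smult v Q) \<noteq> n}"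
    by blast
  moreover have "finite \<dots>"
    using poly_roots_finite[OF W] finite_degree_drop[of P Q] by (simp add: n_def)
  ultimately show False
    using infinite_UNIV_char_0 finite_subset by blast
qed

lemma mobius_reflection_circle_or_line:
  fixes F :: "complex set"
  assumes inf: "infinite F" and nz: "\<gamma> \<noteq> 0 \<or> \<delta> \<noteq> 0"
    and eq: "\<And>z. z \<in> F \<Longrightarrow> (\<gamma> * z + \<delta>) * cnj z = \<alpha> * z + \<beta>"
  shows "(\<exists>c r. r > 0 \<and> F \<subseteq> sphere c r) \<or> (\<exists>a b. a \<noteq> b \<and> F \<subseteq> affine hull {a, b})"
proof -
  obtain a where a: "a \<in> F" using inf by fastforce
  have "F - {a} \<noteq> {}" using inf by (metis finite.emptyI infinite_remove)
  then obtain b where b: "b \<in> F" "b \<noteq> a" by blast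
  show ?thesis
  proof (cases "\<gamma> = 0")
    case False
    define \<alpha>' \<beta>' \<delta>' where defs: "\<alpha>' = \<alpha> / \<gamma>" "\<beta>' = \<beta> / \<gamma>" "\<delta>' = \<delta> / \<gamma>"
    \<comment> \<open>Real parts turn the equation into |z|^2 + 2 Re(k z) = Re
      \<open>\<beta>'\<close>, because \<open>\<delta>' * cnj z\<close> and
      \<open>cnj \<delta>' * z\<close> have the same real part. Completing the square gives the
      centre \<open>- cnj k\<close>.\<close>
    define k where "k = (cnj \<delta>' - \<alpha>') / 2"
    have k: "\<alpha>' = cnj \<delta>' - 2 * k" by (simp add: k_def)
    define c where "c = - cnj k"
    define \<rho> where "\<rho> = Re \<beta>' + (cmod k)\<^sup>2"
    have dist: "(dist c z)\<^sup>2 = \<rho>" if "z \<in> F" for z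
    proof -
      have "z * cnj z + \<delta>' * cnj z = \<alpha>' * z + \<beta>'"
        using eq[OF that] False by (simp add: defs divide_simps algebra_simps)
      then have "Re (z * cnj z + \<delta>' * cnj z) = Re (\<alpha>' * z + \<beta>')"
        by (rule arg_cong)
      then have "(Re z)\<^sup>2 + (Im z)\<^sup>2 + 2 * (Re k * Re z) - 2 * (Im k * Im z) = Re \<beta>'"
        unfolding k by (simp add: algebra_simps power2_eq_square)
      then show ?thesis
        unfolding dist_norm c_def \<rho>_def cmod_power2 by (simp add: power2_eq_square algebra_simps)
    qed
    \<comment> \<open>Two distinct points at the same distance from \<open>c\<close> cannot both be
      \<open>c\<close>.\<close>
    have "\<rho> > 0"
      using dist[OF a] dist[OF b(1)] b(2) by (cases "c = a") (auto simp flip: zero_less_power2)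
    have "dist c z = sqrt \<rho>" if "z \<in> F" for z
      using real_sqrt_unique[OF dist[OF that]] by simp
    then have "F \<subseteq> sphere c (sqrt \<rho>)" by auto
    then show ?thesis using \<open>\<rho> > 0\<close> by (intro disjI1 exI[of _ c] exI[of _ "sqrt \<rho>"]) auto
  next
    case True
    \<comment> \<open>Subtracting the equations at z and \<open>a\<close> leaves a fixed factor, so
      conjugation fixes the quotient (z - a)/(b - a), which is therefore real.\<close>
    then have cnj_diff: "cnj (z - a) = (\<alpha> / \<delta>) * (z - a)" if "z \<in> F" for z
      using eq[OF that] eq[OF a] nz by (simp add: field_simps)
    have "z \<in> affine hull {a, b}" if "z \<in> F" for z
    proof -
      define t where "t = (z - a) / (b - a)"
      have "\<alpha> / \<delta> \<noteq> 0" using cnj_diff[OF b(1)] b(2) by auto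
      then have "cnj t = t"
        using cnj_diff[OF b(1)] cnj_diff[OF that] unfolding t_def complex_cnj_divide by simp
      then have "t = of_real (Re t)" by (simp add: complex_eq_iff)
      moreover have "z = a + t * (b - a)"
        using b(2) by (simp add: t_def)
      ultimately have "z = a + of_real (Re t) * (b - a)" by simp
      then have "z = (1 - Re t) *\<^sub>R a + Re t *\<^sub>R b"
        by (simp add: scaleR_conv_of_real algebra_simps)
      then show ?thesis unfolding affine_hull_2 by force
    qed
    then show ?thesis using b(2) by (intro disjI2 exI[of _ a] exI[of _ b]) auto
  qed
qed

lemma rational_schwarz_function_circle_or_line:
  fixes F :: "complex set"
  assumes F: "infinite F" and Q: "Q \<noteq> 0"
    and eq: "finite {z \<in> F. poly Q z * cnj z \<noteq> poly P z}"
  shows "\<exists>S. finite S \<and>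
          ((\<exists>c r. r > 0 \<and> F - S \<subseteq> sphere c r) \<or>
           (\<exists>a b. a \<noteq> b \<and> F - S \<subseteq> affine hull {a, b}))"
proof -
  obtain P' Q' where PQ': "coprime P' Q'" "Q' \<noteq> 0" "P * Q' = P' * Q"
    using rational_reduce[OF Q] by metis
  define S where "S = {z \<in> F. poly Q z * cnj z \<noteq> poly P z} \<union> {z. poly Q z = 0} \<union> {z. poly Q' z = 0}"
  have S: "finite S"
    unfolding S_def using eq poly_roots_finite Q PQ'(2) by blast
  have w: "poly Q' z \<noteq> 0" "cnj z = poly P' z / poly Q' z" if "z \<in> F - S" for z
  proof -
    show Q'z: "poly Q' z \<noteq> 0" using that by (auto simp: S_def)
    have Qz: "poly Q z \<noteq> 0" "poly Q z * cnj z = poly P z" using that by (auto simp: S_def)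
    have "poly P z * poly Q' z = poly P' z * poly Q z"
      using arg_cong[OF PQ'(3), of "\<lambda>f. poly f z"] by simp
    then have "poly Q z * (cnj z * poly Q' z) = poly Q z * poly P' z"
      unfolding Qz(2)[symmetric] by (simp add: ac_simps)
    then show "cnj z = poly P' z / poly Q' z" using Q'z Qz(1) by (simp add: field_simps)
  qed
  \<comment> \<open>Conjugating cnj z = P'(z)/Q'(z) gives z = Pc(v)/Qc(v) with v = P'(z)/Q'(z).
    \<open>H1\<close> and \<open>H2\<close> clear denominators here, and infinitely many points of
    \<open>F\<close> make this an identity of polynomials, valid off \<open>F\<close> as
    well.\<close>
  define Pc Qc where "Pc = map_poly cnj P'" and "Qc = map_poly cnj Q'"
  have conj: "poly Pc z = cnj (poly P' (cnj z))" "poly Qc z = cnj (poly Q' (cnj z))" for z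
    using poly_cnj[of P' "cnj z"] poly_cnj[of Q' "cnj z"] unfolding Pc_def Qc_def by simp_all
  define n where "n = max (degree Pc) (degree Qc)"
  obtain H1 where H1: "\<And>z. poly Q' z \<noteq> 0 \<Longrightarrow> poly H1 z = poly Q' z ^ n * poly Pc (poly P' z / poly Q' z)"
    using poly_homogenization[of Pc n Q' P'] by (auto simp: n_def)
  obtain H2 where H2: "\<And>z. poly Q' z \<noteq> 0 \<Longrightarrow> poly H2 z = poly Q' z ^ n * poly Qc (poly P' z / poly Q' z)"
    using poly_homogenization[of Qc n Q' P'] by (auto simp: n_def)
  have H_poly: "[:0, 1:] * H2 - H1 = 0"
  proof (rule ccontr)
    assume "[:0, 1:] * H2 - H1 \<noteq> 0"
    then have "finite {z. poly ([:0, 1:] * H2 - H1) z = 0}"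
      by (rule poly_roots_finite)
    moreover have "F - S \<subseteq> {z. poly ([:0, 1:] * H2 - H1) z = 0}"
    proof safe
      fix z assume "z \<in> F" "z \<notin> S"
      then have z: "poly Q' z \<noteq> 0" "cnj z = poly P' z / poly Q' z" using w by auto
      from arg_cong[OF z(2), of cnj] have "z * cnj (poly Q' z) = cnj (poly P' z)"
        using z(1) by (simp add: field_simps)
      then show "poly ([:0, 1:] * H2 - H1) z = 0"
        using z by (simp add: H1 H2 conj flip: z(2))
    qed
    ultimately show False using F S finite_subset by fastforce
  qed
  have H_eq: "z * poly H2 z = poly H1 z" for z
    using arg_cong[OF H_poly, of "\<lambda>f. poly f z"] by simp
  have deg: "degree P' \<le> 1 \<and> degree Q' \<le> 1"
  proof (rule degree_le_1_if_injective[OF PQ'(1)])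
    fix u z assume u: "poly Q' u \<noteq> 0" and z: "poly Q' z \<noteq> 0"
      and eq: "poly P' u / poly Q' u = poly P' z / poly Q' z"
    define v where "v = poly P' z / poly Q' z"
    have "z * poly Qc v = poly Pc v" "u * poly Qc v = poly Pc v"
      using H_eq[of z] H_eq[of u] u z eq by (auto simp: H1 H2 v_def)
    \<comment> \<open>Without a common zero of \<open>Pc\<close> and \<open>Qc\<close>, the value
      \<open>poly Qc v\<close> is nonzero, and v determines its preimage.\<close>
    moreover have "poly Pc v \<noteq> 0 \<or> poly Qc v \<noteq> 0"
      using coprime_poly_0[OF PQ'(1), of "cnj v"] by (auto simp: conj)
    ultimately show "u = z" by (metis mult_cancel_right mult_zero_right)
  qed
  have linear: "\<exists>a b. f = [:a, b:]" if "degree f \<le> 1" for f :: "complex poly"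
    using that by (intro exI[of _ "coeff f 0"] exI[of _ "coeff f 1"] poly_eqI)
      (auto simp: coeff_pCons coeff_eq_0 split: nat.split)
  obtain \<alpha> \<beta> where P': "P' = [:\<beta>, \<alpha>:]" using deg linear by blast
  obtain \<gamma> \<delta> where Q'': "Q' = [:\<delta>, \<gamma>:]" using deg linear by blast
  have "(\<gamma> * z + \<delta>) * cnj z = \<alpha> * z + \<beta>" if "z \<in> F - S" for z
    using w[OF that] by (simp add: P' Q'' field_simps)
  moreover have "infinite (F - S)" using F S by simp
  moreover have "\<gamma> \<noteq> 0 \<or> \<delta> \<noteq> 0" using PQ'(2) Q'' by auto
  ultimately show ?thesis
    using mobius_reflection_circle_or_line[of "F - S" \<gamma> \<delta> \<alpha> \<beta>] S by blast
qed

section \<open>Rational solutions of the Dirichlet problem\<close>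

lemma finite_rh_singularities: "finite {z. rh_singularity h z}"
proof -
  have "finite {z. poly (snd (quot_of_fract r)) z = 0}" for r :: "complex poly fract"
    by (intro poly_roots_finite) simp
  then have "finite ({z. poly (snd (quot_of_fract (fst h))) z = 0} \<union> cnj ` {z. poly (snd (quot_of_fract (snd h))) z = 0})"
    by blast
  moreover have "{z. rh_singularity h z} \<subseteq> {z. poly (snd (quot_of_fract (fst h))) z = 0} \<union> cnj ` {z. poly (snd (quot_of_fract (snd h))) z = 0}"
    by (auto simp: rh_singularity_def is_pole_rat_eval_iff image_iff) (metis complex_cnj_cnj)
  ultimately show ?thesis by (rule finite_subset[rotated])
qed

lemma isCont_rh_eval:
  assumes "\<not> rh_singularity h z"
  shows "isCont (rh_eval h) z"
  using assms unfolding rh_singularity_def is_pole_rat_eval_iff rh_eval_def rat_eval_def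
  by (intro continuous_intros) auto

text \<open>A boundary point is a limit of points of the open set, where the solution equals
  \<open>rh_eval h\<close>. Off the singularities \<open>rh_eval h\<close> is continuous, so both
  limits agree.\<close>

lemma rational_solution_on_frontier:
  assumes "has_rational_solution \<Omega> v" "open \<Omega>"
  obtains h where "\<And>z. z \<in> \<Omega> \<Longrightarrow> \<not> rh_singularity h z"
    "\<And>z. z \<in> frontier \<Omega> \<Longrightarrow> \<not> rh_singularity h z \<Longrightarrow> v z = rh_eval h z"
proof -
  obtain u h where u: "continuous_on (closure \<Omega>) u" "\<And>z. z \<in> frontier \<Omega> \<Longrightarrow> u z = v z"
    and h: "\<And>z. z \<in> \<Omega> \<Longrightarrow> \<not> rh_singularity h z \<and> u z = rh_eval h z"
    using assms(1) unfolding has_rational_solution_def solves_dirichlet_def by blast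
  have "v z = rh_eval h z" if z: "z \<in> frontier \<Omega>" "\<not> rh_singularity h z" for z
  proof -
    have zc: "z \<in> closure \<Omega>" "z \<notin> \<Omega>"
      using z(1) assms(2) by (auto simp: frontier_def interior_open)
    then have nt: "at z within \<Omega> \<noteq> bot"
      by (simp add: at_within_eq_bot_iff)
    have "(u \<longlongrightarrow> u z) (at z within \<Omega>)"
      using u(1) zc(1) closure_subset[of \<Omega>]
      by (auto simp: continuous_on intro: tendsto_within_subset)
    then have "(rh_eval h \<longlongrightarrow> u z) (at z within \<Omega>)"
      using h by (subst tendsto_cong[of _ u]) (auto simp: eventually_at_filter)
    moreover have "(rh_eval h \<longlongrightarrow> rh_eval h z) (at z within \<Omega>)"
      using isCont_rh_eval[OF z(2)] by (auto simp: isCont_def intro: tendsto_within_subset)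
    ultimately show ?thesis using tendsto_unique[OF nt] u(2)[OF z(1)] by metis
  qed
  then show thesis using that h by blast
qed

lemma rat_eval_quotient:
  obtains p q where "coprime p q" "q \<noteq> 0" "rat_eval r = (\<lambda>z. poly p z / poly q z)"
    "\<And>z. is_pole (rat_eval r) z \<longleftrightarrow> poly q z = 0"
proof
  show "coprime (fst (quot_of_fract r)) (snd (quot_of_fract r))"
    using quot_of_fract_in_normalized_fracts[of r] by (auto simp: normalized_fracts_def)
qed (auto simp: rat_eval_def is_pole_rat_eval_iff)

theorem theorem1p4:
  fixes \<Omega> :: "complex set"
  assumes domain: "open \<Omega>" "connected \<Omega>" "\<Omega> \<noteq> {}"
    and polynomial_data: "\<And>p :: complex poly poly. has_rational_solution \<Omega> (poly_z_cnj p)"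
    and singular_data: "\<exists>\<phi> v. (\<exists>z\<in>\<Omega>. rh_singularity \<phi> z) \<and>
          boundary_data_of \<phi> \<Omega> v \<and> has_rational_solution \<Omega> v"
  shows "\<exists>S. finite S \<and>
          ((\<exists>c r. r > 0 \<and> frontier \<Omega> - S \<subseteq> sphere c r) \<or>
           (\<exists>a b. a \<noteq> b \<and> frontier \<Omega> - S \<subseteq> affine hull {a, b}))"
proof (cases "finite (frontier \<Omega>)")
  case True
  \<comment> \<open>With the whole frontier removed, the unit circle serves as well as any
    other.\<close>
  then show ?thesis by (intro exI[of _ "frontier \<Omega>"] conjI disjI1 exI[of _ 0] exI[of _ 1]) auto
next
  case False
  \<comment> \<open>Eventually along \<open>G\<close> means at all but finitely many boundary
    points. Since the frontier is infinite, z and cnj z are then generic points in the sense of the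
    elimination lemmas.\<close>
  define G where "G = inf cofinite (principal (frontier \<Omega>))"
  have evG: "(\<forall>\<^sub>F z in G. R z) \<longleftrightarrow> finite {z \<in> frontier \<Omega>. \<not> R z}" for R
    by (simp add: G_def eventually_inf_principal eventually_cofinite)
  have G: "G \<noteq> bot"
    using False evG[of "\<lambda>_. False"] by (auto simp: trivial_limit_def)
  have id_nz: "\<forall>\<^sub>F z in G. poly f z \<noteq> 0" if "f \<noteq> 0" for f
    using poly_roots_finite[OF that] by (auto simp: evG)
  have cnj_nz: "\<forall>\<^sub>F z in G. poly f (cnj z) \<noteq> 0" if "f \<noteq> 0" for f
  proof -
    have "finite (cnj ` {z. poly f z = 0})" using poly_roots_finite[OF that] by blast
    moreover have "{z \<in> frontier \<Omega>. \<not> poly f (cnj z) \<noteq> 0} \<subseteq> cnj ` {z. poly f z = 0}"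
      by (auto simp: image_iff) (metis complex_cnj_cnj)
    ultimately show ?thesis unfolding evG by (rule finite_subset[rotated])
  qed
  have nonsing: "\<forall>\<^sub>F z in G. z \<in> frontier \<Omega> \<and> \<not> rh_singularity h z" for h
    unfolding evG by (rule finite_subset[OF _ finite_rh_singularities[of h]]) auto
  have split: "\<exists>a c b e. c \<noteq> 0 \<and> e \<noteq> 0 \<and>
      (\<forall>\<^sub>F z in G. poly_z_cnj f z = poly a z / poly c z + poly b (cnj z) / poly e (cnj z))" for f
  proof -
    obtain h where h: "\<And>z. z \<in> frontier \<Omega> \<Longrightarrow> \<not> rh_singularity h z \<Longrightarrow> poly_z_cnj f z = rh_eval h z"
      using rational_solution_on_frontier[OF polynomial_data domain(1)] by metis
    obtain a c where ac: "c \<noteq> 0" "rat_eval (fst h) = (\<lambda>z. poly a z / poly c z)"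
      by (rule rat_eval_quotient)
    obtain b e where be: "e \<noteq> 0" "rat_eval (snd h) = (\<lambda>z. poly b z / poly e z)"
      by (rule rat_eval_quotient)
    have "\<forall>\<^sub>F z in G. poly_z_cnj f z = poly a z / poly c z + poly b (cnj z) / poly e (cnj z)"
      using nonsing[of h] by eventually_elim (auto simp: h rh_eval_def ac be)
    then show ?thesis using ac be by blast
  qed
  \<comment> \<open>The first family of data serves when A has at least the degree of B, the second
    in the opposite case.\<close>
  have monom_z: "poly_z_cnj (monom (monom 1 i) 1) z = z ^ i * cnj z"
    and monom_cnj: "poly_z_cnj (monom (monom 1 1) i) z = cnj z ^ i * z" for i z
    by (simp_all add: poly_z_cnj_def poly_monom)
  from singular_data obtain \<phi> v z0 where z0: "z0 \<in> \<Omega>" "rh_singularity \<phi> z0"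
    and v: "boundary_data_of \<phi> \<Omega> v" "has_rational_solution \<Omega> v"
    by blast
  obtain h where h: "\<And>z. z \<in> \<Omega> \<Longrightarrow> \<not> rh_singularity h z"
    "\<And>z. z \<in> frontier \<Omega> \<Longrightarrow> \<not> rh_singularity h z \<Longrightarrow> v z = rh_eval h z"
    using rational_solution_on_frontier[OF v(2) domain(1)] by blast
  obtain p1 q1 where 1: "coprime p1 q1" "q1 \<noteq> 0" "rat_eval (fst \<phi>) = (\<lambda>z. poly p1 z / poly q1 z)"
    "\<And>z. is_pole (rat_eval (fst \<phi>)) z \<longleftrightarrow> poly q1 z = 0"
    by (rule rat_eval_quotient[of "fst \<phi>"]) (rule that)
  obtain p2 q2 where 2: "coprime p2 q2" "q2 \<noteq> 0" "rat_eval (fst h) = (\<lambda>z. poly p2 z / poly q2 z)"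
    "\<And>z. is_pole (rat_eval (fst h)) z \<longleftrightarrow> poly q2 z = 0"
    by (rule rat_eval_quotient[of "fst h"]) (rule that)
  obtain p3 q3 where 3: "coprime p3 q3" "q3 \<noteq> 0" "rat_eval (snd \<phi>) = (\<lambda>z. poly p3 z / poly q3 z)"
    "\<And>z. is_pole (rat_eval (snd \<phi>)) z \<longleftrightarrow> poly q3 z = 0"
    by (rule rat_eval_quotient[of "snd \<phi>"]) (rule that)
  obtain p4 q4 where 4: "coprime p4 q4" "q4 \<noteq> 0" "rat_eval (snd h) = (\<lambda>z. poly p4 z / poly q4 z)"
    "\<And>z. is_pole (rat_eval (snd h)) z \<longleftrightarrow> poly q4 z = 0"
    by (rule rat_eval_quotient[of "snd h"]) (rule that)
  \<comment> \<open>The differences of the components of \<open>\<phi>\<close> and \<open>h\<close>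
    in lowest terms: A = p/q and B = -r/s.\<close>
  obtain p q where pq: "coprime p q" "q \<noteq> 0" "(p1 * q2 - p2 * q1) * q = p * (q1 * q2)"
    using rational_reduce[of "q1 * q2" "p1 * q2 - p2 * q1"] 1(2) 2(2) by auto
  obtain r s where rs: "coprime r s" "s \<noteq> 0" "(p3 * q4 - p4 * q3) * s = r * (q3 * q4)"
    using rational_reduce[of "q3 * q4" "p3 * q4 - p4 * q3"] 3(2) 4(2) by auto
  have frac_eq: "poly f1 z / poly g1 z - poly f2 z / poly g2 z = poly f z / poly g z"
    if "(f1 * g2 - f2 * g1) * g = f * (g1 * g2)" "poly g1 z \<noteq> 0" "poly g2 z \<noteq> 0" "poly g z \<noteq> 0"
    for f1 g1 f2 g2 f g :: "complex poly" and z
  proof -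
    have "(poly f1 z * poly g2 z - poly f2 z * poly g1 z) * poly g z = poly f z * (poly g1 z * poly g2 z)"
      using arg_cong[OF that(1), of "\<lambda>k. poly k z"] by simp
    then show ?thesis using that(2-) by (simp add: divide_simps mult.commute)
  qed
  have eq: "\<forall>\<^sub>F z in G. poly p z / poly q z = poly (- r) (cnj z) / poly s (cnj z)"
    using nonsing[of \<phi>] nonsing[of h] id_nz[OF pq(2)] cnj_nz[OF rs(2)]
  proof eventually_elim
    case (elim z)
    then have "rh_eval \<phi> z = rh_eval h z"
      using v(1) h(2) unfolding boundary_data_of_def by metis
    then have "poly p1 z / poly q1 z - poly p2 z / poly q2 z =
        - (poly p3 (cnj z) / poly q3 (cnj z) - poly p4 (cnj z) / poly q4 (cnj z))"
      unfolding rh_eval_def 1(3) 2(3) 3(3) 4(3) by (simp add: algebra_simps)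
    moreover have "poly q1 z \<noteq> 0" "poly q2 z \<noteq> 0" "poly q3 (cnj z) \<noteq> 0" "poly q4 (cnj z) \<noteq> 0"
      using elim by (auto simp: rh_singularity_def 1(4) 2(4) 3(4) 4(4))
    ultimately show ?case
      using frac_eq[OF pq(3), of z] frac_eq[OF rs(3), of "cnj z"] elim by simp
  qed
  then have eq': "\<forall>\<^sub>F z in G. poly (- r) (cnj z) / poly s (cnj z) = poly p z / poly q z"
    by eventually_elim (rule sym)
  \<comment> \<open>\<open>z0\<close> is a singularity of \<open>\<phi>\<close> but not of
    \<open>h\<close>, so A or B is nonconstant, and then so is the other.\<close>
  have deg: "0 < max (degree p) (degree q)" "0 < max (degree (- r)) (degree s)"
  proof -
    have "poly q1 z0 = 0 \<or> poly q3 (cnj z0) = 0" "poly q2 z0 \<noteq> 0" "poly q4 (cnj z0) \<noteq> 0"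
      using z0 h(1)[of z0] by (auto simp: rh_singularity_def 1(4) 2(4) 3(4) 4(4))
    then have "0 < max (degree p) (degree q) \<or> 0 < max (degree r) (degree s)"
      using reduced_difference_nonconstant[OF 1(1) _ _ pq(3,2), of z0]
        reduced_difference_nonconstant[OF 3(1) _ _ rs(3,2), of "cnj z0"]
      by metis
    moreover have "degree p = 0 \<and> degree q = 0" if "degree r = 0" "degree s = 0"
      by (rule rational_eq_constant[OF G id_nz pq(1,2) _ _ eq]) (use that in auto)
    moreover have "degree (- r) = 0 \<and> degree s = 0" if "degree p = 0" "degree q = 0"
      by (rule rational_eq_constant[OF G cnj_nz _ rs(2) that eq']) (use rs(1) in simp_all)
    ultimately show "0 < max (degree p) (degree q)" "0 < max (degree (- r)) (degree s)"
      unfolding less_max_iff_disj degree_minus by (metis neq0_conv)+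
  qed
  have "\<exists>P Q. Q \<noteq> 0 \<and> (\<forall>\<^sub>F z in G. poly Q z * cnj z = poly P z)"
  proof (cases "max (degree (- r)) (degree s) \<le> max (degree p) (degree q)")
    case True
    then show ?thesis
      by (intro rational_relation_of_lower_degree[OF G id_nz cnj_nz pq(1,2) rs(2) _ deg(2) eq])
        (use split[of "monom (monom 1 _) 1", unfolded monom_z] in blast)+
  next
    case False
    \<comment> \<open>The roles of z and cnj z are exchanged; conjugating the coefficients
      afterwards restores the required form.\<close>
    have "\<exists>P Q. Q \<noteq> 0 \<and> (\<forall>\<^sub>F z in G. poly Q (cnj z) * z = poly P (cnj z))"
    proof (rule rational_relation_of_lower_degree[OF G cnj_nz id_nz _ rs(2) pq(2) _ deg(1) eq'])
      show "coprime (- r) s" using rs(1) by simp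
      show "max (degree p) (degree q) \<le> max (degree (- r)) (degree s)" using False by linarith
      show "\<exists>a c b e. c \<noteq> 0 \<and> e \<noteq> 0 \<and>
          (\<forall>\<^sub>F z in G. cnj z ^ i * z = poly a (cnj z) / poly c (cnj z) + poly b z / poly e z)" for i
      proof -
        obtain a c b e where "c \<noteq> 0" "e \<noteq> 0"
          and *: "\<forall>\<^sub>F z in G. cnj z ^ i * z = poly a z / poly c z + poly b (cnj z) / poly e (cnj z)"
          using split[of "monom (monom 1 1) i", unfolded monom_cnj] by blast
        moreover from * have "\<forall>\<^sub>F z in G. cnj z ^ i * z = poly b (cnj z) / poly e (cnj z) + poly a z / poly c z"
          by eventually_elim (simp only: add.commute)
        ultimately show ?thesis by blast
      qed
    qed
    then obtain P Q where PQ: "Q \<noteq> 0" "\<forall>\<^sub>F z in G. poly Q (cnj z) * z = poly P (cnj z)" by blast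
    have "\<forall>\<^sub>F z in G. poly (map_poly cnj Q) z * cnj z = poly (map_poly cnj P) z"
      using PQ(2)
    proof eventually_elim
      case (elim z)
      from arg_cong[OF elim, of cnj] show ?case
        by (simp only: complex_cnj_mult poly_cnj complex_cnj_cnj)
    qed
    moreover have "map_poly cnj Q \<noteq> 0" using PQ(1) by (auto simp: poly_eq_iff coeff_map_poly)
    ultimately show ?thesis by blast
  qed
  then show ?thesis
    using rational_schwarz_function_circle_or_line[OF False] unfolding evG by blast
qed

end
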